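(* Let $C_A(\mathbf K,B,\mathbf\Gamma)$ be as in the context. If $\mathbf\Gamma=\gamma_C\mathbf 1$ (i.e. $\gamma^{(k_0)}=\gamma_C$ for all $k_0\in\mathcal K_0$) for some $\gamma_C\in(0,\frac1L]$, then $$C_A(\mathbf K,B,\mathbf\Gamma)=\frac{c_1}{\gamma_CK_0\sum_{n\in\mathcal N}K_n}+c_2\gamma_C^2\max_{n\in\mathcal N}K_n^2+\frac{c_3\gamma_C}{B}+\frac{c_4\gamma_C\sum_{n\in\mathcal N}q_{s_0,s_n}K_n^2}{\sum_{n\in\mathcal N}K_n}\triangleq C_C(\mathbf K,B,\mathbf\Gamma),$$ and, as $K_0\to\infty$ (the other quantities being fixed), $$C_C(\mathbf K,B,\mathbf\Gamma)\to c_2\gamma_C^2\max_{n\in\mathcal N}K_n^2+\frac{c_3\gamma_C}{B}+\frac{c_4\gamma_C\sum_{n\in\mathcal N}q_{s_0,s_n}K_n^2}{\sum_{n\in\mathcal N}K_n}.$$ Furthermore, if $\mathbf\Gamma=\gamma_C\mathbf 1$ with $\gamma_C=\frac{\sqrt N}{L\sqrt{K_0\bar K}}$, and $K_n=\bar K$, $q_{s_0,s_n}=\frac1{N\bar K}$ for all $n\in\mathcal N$, with $\bar K\le\frac{(K_0\bar K)^{1/4}}{N^{3/4}}$, then $C_A(\mathbf K,B,\mathbf\Gamma)=\mathcal O(K_0^{-1/2})$ as $K_0\to\infty$.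
   Context: $N\in\mathbb Z_+$, $\mathcal N=\{1,\dots,N\}$; $\mathbf K=(K_0,K_1,\dots,K_N)\in\mathbb Z_+^{N+1}$, $B\in\mathbb Z_+$, $\mathcal K_0=\{1,\dots,K_0\}$, $\mathbf\Gamma=(\gamma^{(1)},\dots,\gamma^{(K_0)})$ is a vector of positive step sizes, $\bar K\in\mathbb Z_+$. $q_{s_0,s_n}>0$ ($n\in\mathcal N$) are quantization constants. $L,\sigma,G>0$ are constants and $c_1=2N\delta$ with $\delta=f(\hat{\mathbf x}^{(1)})-f^*\ge0$ a fixed constant (initial optimality gap), $c_2=4G^2L^2$, $c_3=\frac{L\sigma^2}{N}$, $c_4=2LG^2$. Define $$C_A(\mathbf K,B,\mathbf\Gamma)=\frac{c_1}{\sum_{n\in\mathcal N}K_n\sum_{k_0\in\mathcal K_0}\gamma^{(k_0)}}+\frac{c_2\max_{n\in\mathcal N}K_n^2\sum_{k_0\in\mathcal K_0}(\gamma^{(k_0)})^3}{\sum_{k_0\in\mathcal K_0}\gamma^{(k_0)}}+\frac{c_3\sum_{k_0\in\mathcal K_0}(\gamma^{(k_0)})^2}{B\sum_{k_0\in\mathcal K_0}\gamma^{(k_0)}}+\frac{c_4\sum_{n\in\mathcal N}q_{s_0,s_n}K_n^2\sum_{k_0\in\mathcal K_0}(\gamma^{(k_0)})^2}{\sum_{n\in\mathcal N}K_n\sum_{k_0\in\mathcal K_0}\gamma^{(k_0)}}.$$ In the $\mathcal O(\cdot)$ statement, $N,B,\bar K,L,\sigma,G,\delta$ are regarded as fixed.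 *)

theory Defs
  imports Complex_Main "HOL-Library.Landau_Symbols"
begin

definition c1 :: "nat \<Rightarrow> real \<Rightarrow> real" where
  "c1 N \<delta> = 2 * real N * \<delta>"

definition c2 :: "real \<Rightarrow> real \<Rightarrow> real" where
  "c2 L G = 4 * G\<^sup>2 * L\<^sup>2"

definition c3 :: "nat \<Rightarrow> real \<Rightarrow> real \<Rightarrow> real" where
  "c3 N L \<sigma> = L * \<sigma>\<^sup>2 / real N"

definition c4 :: "real \<Rightarrow> real \<Rightarrow> real" where
  "c4 L G = 2 * L * G\<^sup>2"

text \<open>
  The vector \<open>(K\<^sub>0, K\<^sub>1, \<dots>, K\<^sub>N)\<close> is a function \<open>K\<close> read only on \<open>{0..N}\<close>, the step
  sizes are a function \<open>\<Gamma>\<close> read only on \<open>{1..K 0}\<close>, and \<open>q n\<close> stands for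
  \<open>q\<close> with index pair \<open>(s\<^sub>0, s\<^sub>n)\<close>, read only on \<open>{1..N}\<close>. The number \<open>\<delta>\<close> is the initial
  optimality gap.
\<close>

definition C_A :: "nat \<Rightarrow> real \<Rightarrow> real \<Rightarrow> real \<Rightarrow> real \<Rightarrow> (nat \<Rightarrow> real)
    \<Rightarrow> (nat \<Rightarrow> nat) \<Rightarrow> nat \<Rightarrow> (nat \<Rightarrow> real) \<Rightarrow> real" where
  "C_A N L \<sigma> G \<delta> q K B \<Gamma> =
     c1 N \<delta> / ((\<Sum>n\<in>{1..N}. real (K n)) * (\<Sum>k\<in>{1..K 0}. \<Gamma> k))
   + c2 L G * (MAX n\<in>{1..N}. (real (K n))\<^sup>2) * (\<Sum>k\<in>{1..K 0}. \<Gamma> k ^ 3)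
       / (\<Sum>k\<in>{1..K 0}. \<Gamma> k)
   + c3 N L \<sigma> * (\<Sum>k\<in>{1..K 0}. (\<Gamma> k)\<^sup>2) / (real B * (\<Sum>k\<in>{1..K 0}. \<Gamma> k))
   + c4 L G * (\<Sum>n\<in>{1..N}. q n * (real (K n))\<^sup>2) * (\<Sum>k\<in>{1..K 0}. (\<Gamma> k)\<^sup>2)
       / ((\<Sum>n\<in>{1..N}. real (K n)) * (\<Sum>k\<in>{1..K 0}. \<Gamma> k))"

text \<open>The last argument is the common value of the entries of a constant step size vector.\<close>

definition C_C :: "nat \<Rightarrow> real \<Rightarrow> real \<Rightarrow> real \<Rightarrow> real \<Rightarrow> (nat \<Rightarrow> real)
    \<Rightarrow> (nat \<Rightarrow> nat) \<Rightarrow> nat \<Rightarrow> real \<Rightarrow> real" where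
  "C_C N L \<sigma> G \<delta> q K B \<gamma> =
     c1 N \<delta> / (\<gamma> * real (K 0) * (\<Sum>n\<in>{1..N}. real (K n)))
   + c2 L G * \<gamma>\<^sup>2 * (MAX n\<in>{1..N}. (real (K n))\<^sup>2)
   + c3 N L \<sigma> * \<gamma> / real B
   + c4 L G * \<gamma> * (\<Sum>n\<in>{1..N}. q n * (real (K n))\<^sup>2) / (\<Sum>n\<in>{1..N}. real (K n))"

end

theory Submission
  imports Defs
begin

text \<open>With a constant step \<gamma> each power sum of the steps is \<open>K 0\<close> times a
  power of \<gamma>, so every quotient in \<open>C_A\<close> collapses to a monomial in \<gamma>;
  this gives \<open>C_C\<close> (\<open>C_A_constant_step\<close>). In \<open>C_C\<close> the number
  of rounds occurs only in the denominator of the \<open>c1\<close> term, which therefore vanishes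
  in the limit (\<open>C_C_tendsto\<close>). For the rate, \<gamma> is a constant over sqrt K0: the
  \<open>c1\<close> term is of order 1/(\<gamma> K0), the \<open>c2\<close> term of order \<gamma>^2
  and the other two of order \<gamma>, that is K0^(-1/2), K0^(-1) and K0^(-1/2)
  (\<open>C_A_bigo\<close>).\<close>

lemma C_A_constant_step:
  assumes "K 0 \<ge> 1" and "\<gamma> > 0" and "\<forall>k\<in>{1..K 0}. \<Gamma> k = \<gamma>"
  shows "C_A N L \<sigma> G \<delta> q K B \<Gamma> = C_C N L \<sigma> G \<delta> q K B \<gamma>"
proof -
  have pow: "(\<Sum>k\<in>{1..K 0}. \<Gamma> k ^ m) = real (K 0) * \<gamma> ^ m" for m
    using assms(3) by simp
  have lin: "(\<Sum>k\<in>{1..K 0}. \<Gamma> k) = real (K 0) * \<gamma>"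
    using pow[of 1] by simp
  have pos: "K 0 \<noteq> 0" "\<gamma> \<noteq> 0"
    using assms(1,2) by simp_all
  \<comment> \<open>The nonzero factor \<open>real (K 0) * \<gamma>\<close> cancels, so cubes leave
    \<gamma>^2 and squares leave \<gamma>. The variable \<open>b\<close> stands for
    \<open>real B\<close> or for the sum of the local counts.\<close>
  have 2: "c * m * (real (K 0) * \<gamma> ^ 3) / (real (K 0) * \<gamma>) = c * \<gamma>\<^sup>2 * m" for c m :: real
    using pos by (simp add: power2_eq_square power3_eq_cube)
  have 3: "c * (real (K 0) * \<gamma>\<^sup>2) / (b * (real (K 0) * \<gamma>)) = c * \<gamma> / b" for c b :: real
    using pos by (simp add: power2_eq_square)
  have 4: "c * s * (real (K 0) * \<gamma>\<^sup>2) / (b * (real (K 0) * \<gamma>)) = c * \<gamma> * s / b" for c s b :: real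
    using 3[of "c * s" b] by (simp add: mult_ac)
  show ?thesis
    unfolding C_A_def C_C_def pow lin 2 3 4 by (simp add: mult_ac)
qed

lemma C_C_tendsto:
  "(\<lambda>K0 :: nat. C_C N L \<sigma> G \<delta> q (K(0 := K0)) B \<gamma>) \<longlonglongrightarrow>
     c2 L G * \<gamma>\<^sup>2 * (MAX n\<in>{1..N}. (real (K n))\<^sup>2)
     + c3 N L \<sigma> * \<gamma> / real B
     + c4 L G * \<gamma> * (\<Sum>n\<in>{1..N}. q n * (real (K n))\<^sup>2) / (\<Sum>n\<in>{1..N}. real (K n))"
  (is "_ \<longlonglongrightarrow> ?l")
proof -
  define M where "M = (\<Sum>n\<in>{1..N}. real (K n))"
  \<comment> \<open>The index 0 lies outside \<open>{1..N}\<close>, so the sums and the maximum do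
    not see the update of \<open>K\<close> at 0.\<close>
  have upd: "(\<Sum>n\<in>{1..N}. h n ((K(0 := K0)) n)) = (\<Sum>n\<in>{1..N}. h n (K n))"
    for h :: "nat \<Rightarrow> nat \<Rightarrow> real" and K0
    by (intro sum.cong) auto
  have updM: "(MAX n\<in>{1..N}. (real ((K(0 := K0)) n))\<^sup>2) = (MAX n\<in>{1..N}. (real (K n))\<^sup>2)" for K0
    by (intro arg_cong[where f = Max] image_cong) auto
  \<comment> \<open>No side condition on \<open>K0\<close>: at 0 both sides reduce to
    \<open>?l\<close>, since division by zero yields 0.\<close>
  have eq: "C_C N L \<sigma> G \<delta> q (K(0 := K0)) B \<gamma> = c1 N \<delta> / (\<gamma> * M) * inverse (real K0) + ?l" for K0
    unfolding C_C_def updM upd[of "\<lambda>n k. real k"] upd[of "\<lambda>n k. q n * (real k)\<^sup>2"] M_def[symmetric]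
    by (simp add: divide_inverse mult_ac)
  have "(\<lambda>K0. c1 N \<delta> / (\<gamma> * M) * inverse (real K0) + ?l) \<longlonglongrightarrow> c1 N \<delta> / (\<gamma> * M) * 0 + ?l"
    by (intro tendsto_intros lim_inverse_n)
  then show ?thesis
    unfolding eq by simp
qed

text \<open>The choice of q makes the quantization sum N * Kbar^2 / (N * Kbar) = Kbar. Dividing it
  by the total N * Kbar leaves 1/N, so the \<open>c4\<close> term joins the \<open>c3\<close> term
  as a multiple of \<gamma>.\<close>

lemma C_C_equal_parameters:
  assumes "N \<ge> 1" and "Kbar \<ge> 1"
  shows "C_C N L \<sigma> G \<delta> (\<lambda>n. 1 / (real N * real Kbar)) ((\<lambda>n. Kbar)(0 := K0)) B \<gamma> =
    c1 N \<delta> / (real N * real Kbar) / (\<gamma> * real K0) + c2 L G * (real Kbar)\<^sup>2 * \<gamma>\<^sup>2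
      + (c3 N L \<sigma> / real B + c4 L G / real N) * \<gamma>"
proof -
  let ?K = "(\<lambda>n. Kbar)(0 := K0)"
  have 1: "(\<Sum>n\<in>{1..N}. real (?K n)) = real N * real Kbar"
    by simp
  have 2: "(\<Sum>n\<in>{1..N}. 1 / (real N * real Kbar) * (real (?K n))\<^sup>2) = real Kbar"
    using assms by (simp add: power2_eq_square)
  \<comment> \<open>\<open>N \<ge> 1\<close> makes this image a singleton rather than empty, so that
    its maximum is known.\<close>
  have "(\<lambda>n. (real (?K n))\<^sup>2) ` {1..N} = {(real Kbar)\<^sup>2}"
    using assms by (auto simp: image_iff)
  then have 3: "(MAX n\<in>{1..N}. (real (?K n))\<^sup>2) = (real Kbar)\<^sup>2"
    by simp
  show ?thesis
    unfolding C_C_def 1 2 3 using assms by (simp add: field_simps)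
qed

text \<open>All three powers of K0 in the collapsed bound are explicit, and the slowest to decay is
  K0^(-1/2).\<close>

lemma C_A_bigo:
  assumes "N \<ge> 1" and "Kbar \<ge> 1" and "L > 0"
  shows "(\<lambda>K0 :: nat. C_A N L \<sigma> G \<delta> (\<lambda>n. 1 / (real N * real Kbar)) ((\<lambda>n. Kbar)(0 := K0)) B
          (\<lambda>k. sqrt (real N) / (L * sqrt (real K0 * real Kbar))))
       \<in> O(\<lambda>K0. real K0 powr (- 1/2))"
proof -
  \<comment> \<open>The step size is \<open>a / sqrt K0\<close>; \<open>A\<close>, \<open>E\<close>
    and \<open>F\<close> collect what remains of each term once the power of K0 is split
    off.\<close>
  define a where "a = sqrt (real N) / (L * sqrt (real Kbar))"
  define A where "A = c1 N \<delta> / (real N * real Kbar * a)"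
  define E where "E = c2 L G * (real Kbar)\<^sup>2 * a\<^sup>2"
  define F where "F = (c3 N L \<sigma> / real B + c4 L G / real N) * a"
  define f where "f = (\<lambda>K0 :: nat. A * real K0 powr (- 1/2) + E * inverse (real K0)
    + F * real K0 powr (- 1/2))"
  have a: "a > 0"
    using assms by (simp add: a_def)
  have eq: "C_A N L \<sigma> G \<delta> (\<lambda>n. 1 / (real N * real Kbar)) ((\<lambda>n. Kbar)(0 := K0)) B
      (\<lambda>k. sqrt (real N) / (L * sqrt (real K0 * real Kbar))) = f K0"
    if "K0 \<ge> 1" for K0
  proof -
    let ?r = "sqrt (real K0)"
    have r: "?r > 0"
      using that by simp
    have step: "sqrt (real N) / (L * sqrt (real K0 * real Kbar)) = a / ?r"
      by (simp add: a_def real_sqrt_mult mult_ac)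
    have powr: "real K0 powr (- 1/2) = 1 / ?r"
      using that by (simp add: powr_minus_divide powr_half_sqrt)
    have A: "c1 N \<delta> / (real N * real Kbar) / (a / ?r * real K0) = A * (1 / ?r)"
    proof -
      \<comment> \<open>The total step length grows like sqrt K0, because K0 / sqrt K0 = sqrt
        K0.\<close>
      have "a / ?r * real K0 = a * ?r"
        using real_div_sqrt[of "real K0"] by (metis of_nat_0_le_iff times_divide_eq_left times_divide_eq_right)
      then show ?thesis
        by (simp add: A_def mult_ac)
    qed
    have E: "c2 L G * (real Kbar)\<^sup>2 * (a / ?r)\<^sup>2 = E * inverse (real K0)"
      by (simp add: E_def power_divide) (simp add: divide_inverse)
    have "C_A N L \<sigma> G \<delta> (\<lambda>n. 1 / (real N * real Kbar)) ((\<lambda>n. Kbar)(0 := K0)) B (\<lambda>k. a / ?r)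
        = C_C N L \<sigma> G \<delta> (\<lambda>n. 1 / (real N * real Kbar)) ((\<lambda>n. Kbar)(0 := K0)) B (a / ?r)"
      using that a r by (intro C_A_constant_step) auto
    also have "\<dots> = f K0"
      unfolding C_C_equal_parameters[OF assms(1,2)] f_def powr A E by (simp add: F_def)
    finally show ?thesis
      unfolding step .
  qed
  have "inverse (real K0) \<le> real K0 powr (- 1/2)" if "K0 \<ge> 1" for K0 :: nat
    using that powr_mono[of "- 1" "- 1/2" "real K0"] by (simp add: powr_minus)
  then have inv: "(\<lambda>K0. inverse (real K0)) \<in> O(\<lambda>K0. real K0 powr (- 1/2))"
    by (intro bigoI[of _ 1] eventually_sequentiallyI[of 1]) simp
  have "f \<in> O(\<lambda>K0. real K0 powr (- 1/2))"
    \<comment> \<open>A constant factor cancels inside O when it is nonzero; for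
      \<open>E = 0\<close> the middle summand is zero, hence the case split.\<close>
    unfolding f_def by (intro sum_in_bigo) (use inv in \<open>cases "E = 0"; simp\<close>)+
  moreover have "(\<lambda>K0 :: nat. C_A N L \<sigma> G \<delta> (\<lambda>n. 1 / (real N * real Kbar))
      ((\<lambda>n. Kbar)(0 := K0)) B (\<lambda>k. sqrt (real N) / (L * sqrt (real K0 * real Kbar))))
    \<in> \<Theta>(f)"
    \<comment> \<open>Agreement from 1 on suffices for an asymptotic statement; at K0 = 0 the step
      would be 0.\<close>
    by (intro bigthetaI_cong eventually_sequentiallyI[of 1] eq)
  ultimately show ?thesis
    using landau_o.big_trans bigthetaD1 by blast
qed

theorem lemma1:
  fixes N B Kbar :: nat and L \<sigma> G \<delta> :: real
  assumes "N \<ge> 1" and "B \<ge> 1" and "Kbar \<ge> 1"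
    and "L > 0" and "\<sigma> > 0" and "G > 0" and "\<delta> \<ge> 0"
  shows
    "(\<forall>(K :: nat \<Rightarrow> nat) (q :: nat \<Rightarrow> real) (\<gamma> :: real) (\<Gamma> :: nat \<Rightarrow> real).
        (\<forall>n\<in>{0..N}. K n \<ge> 1) \<longrightarrow> (\<forall>n\<in>{1..N}. q n > 0) \<longrightarrow>
        \<gamma> \<in> {0<..1 / L} \<longrightarrow> (\<forall>k\<in>{1..K 0}. \<Gamma> k = \<gamma>) \<longrightarrow>
        C_A N L \<sigma> G \<delta> q K B \<Gamma> = C_C N L \<sigma> G \<delta> q K B \<gamma>)
   \<and> (\<forall>(K :: nat \<Rightarrow> nat) (q :: nat \<Rightarrow> real) (\<gamma> :: real).
        (\<forall>n\<in>{1..N}. K n \<ge> 1) \<longrightarrow> (\<forall>n\<in>{1..N}. q n > 0) \<longrightarrow>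
        \<gamma> \<in> {0<..1 / L} \<longrightarrow>
        (\<lambda>K0 :: nat. C_C N L \<sigma> G \<delta> q (K(0 := K0)) B \<gamma>) \<longlonglongrightarrow>
          c2 L G * \<gamma>\<^sup>2 * (MAX n\<in>{1..N}. (real (K n))\<^sup>2)
          + c3 N L \<sigma> * \<gamma> / real B
          + c4 L G * \<gamma> * (\<Sum>n\<in>{1..N}. q n * (real (K n))\<^sup>2) / (\<Sum>n\<in>{1..N}. real (K n)))
   \<and> (\<lambda>K0 :: nat. C_A N L \<sigma> G \<delta> (\<lambda>n. 1 / (real N * real Kbar)) ((\<lambda>n. Kbar)(0 := K0)) B
          (\<lambda>k. sqrt (real N) / (L * sqrt (real K0 * real Kbar))))
       \<in> O[inf sequentially (principal
             {K0. real Kbar \<le> (real K0 * real Kbar) powr (1/4) / real N powr (3/4)})](\<lambda>K0. real K0 powr (- 1/2))"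
proof (intro conjI)
  show "\<forall>(K :: nat \<Rightarrow> nat) (q :: nat \<Rightarrow> real) (\<gamma> :: real) (\<Gamma> :: nat \<Rightarrow> real).
        (\<forall>n\<in>{0..N}. K n \<ge> 1) \<longrightarrow> (\<forall>n\<in>{1..N}. q n > 0) \<longrightarrow>
        \<gamma> \<in> {0<..1 / L} \<longrightarrow> (\<forall>k\<in>{1..K 0}. \<Gamma> k = \<gamma>) \<longrightarrow>
        C_A N L \<sigma> G \<delta> q K B \<Gamma> = C_C N L \<sigma> G \<delta> q K B \<gamma>"
    by (intro allI impI C_A_constant_step) auto
next
  show "(\<lambda>K0 :: nat. C_A N L \<sigma> G \<delta> (\<lambda>n. 1 / (real N * real Kbar)) ((\<lambda>n. Kbar)(0 := K0)) B
          (\<lambda>k. sqrt (real N) / (L * sqrt (real K0 * real Kbar))))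
       \<in> O[inf sequentially (principal
             {K0. real Kbar \<le> (real K0 * real Kbar) powr (1/4) / real N powr (3/4)})](\<lambda>K0. real K0 powr (- 1/2))"
    \<comment> \<open>An O-bound along \<open>sequentially\<close> is inherited by the smaller
      filter in which K0 tends to infinity within the admissible set.\<close>
    using C_A_bigo[OF assms(1,3,4)] by (rule landau_o.big.filter_mono[rotated]) simp
qed (intro allI impI C_C_tendsto)

end
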